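(* Let $n\ge 2$ agents share an identical additive valuation $v:2^M\to\mathbb{R}_{\ge 0}$ on a finite set $M$ of indivisible goods, and let $A^*$ be an allocation maximizing $\operatorname{NSW}$ among all allocations of $M$; assume $\operatorname{NSW}(A^* )>0$. Put $\mu=v(M)/n$ and $v^*=\max_{g\in M}v(g)$. Let $\varepsilon\in[0,1]$ and assume the $\varepsilon$-small-item condition $v^*\le\varepsilon\mu$. Then every EF1 allocation $A$ of $M$ satisfies $$\frac{\operatorname{NSW}(A)}{\operatorname{NSW}(A^* )}\ \ge\ \max\{e^{-1/e},\ \rho_n(\varepsilon)\},$$ where $$\rho_n(\varepsilon)=\left[\min_{1\le k\le n-1}\left(1-\frac{k\varepsilon}{n}\right)^{n-k}\left(1+\frac{(n-k)\varepsilon}{n}\right)^{k}\right]^{1/n}$$ (the minimum being over integers $k$).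
   Context: An allocation is a partition $A=(A_1,\dots,A_n)$ of $M$ into $n$ pairwise disjoint (possibly empty) bundles whose union is $M$. Additive means $v(S)=\sum_{g\in S}v(g)$ for all $S\subseteq M$. The Nash social welfare is $\operatorname{NSW}(A)=\left(\prod_{i=1}^n v(A_i)\right)^{1/n}$. The allocation $A$ is EF1 (envy-free up to one good) if for every pair of agents $i,j$ with $A_j\neq\emptyset$ there exists $g\in A_j$ such that $v(A_i)\ge v(A_j\setminus\{g\})$. *)

theory Defs
  imports "HOL-Analysis.Analysis"
begin

text \<open>Goods are the elements of a set \<open>M\<close>; agents are \<open>1, \<dots>, n\<close>. A valuation is a set function
  of which only the values on subsets of \<open>M\<close> matter, and the value of a good \<open>g\<close> is \<open>v {g}\<close>.\<close>

definition additive_valuation :: "'g set \<Rightarrow> ('g set \<Rightarrow> real) \<Rightarrow> bool" where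
  "additive_valuation M v \<longleftrightarrow>
     (\<forall>S. S \<subseteq> M \<longrightarrow> v S \<ge> 0) \<and> (\<forall>S. S \<subseteq> M \<longrightarrow> v S = (\<Sum>g\<in>S. v {g}))"

definition allocation :: "nat \<Rightarrow> 'g set \<Rightarrow> (nat \<Rightarrow> 'g set) \<Rightarrow> bool" where
  "allocation n M A \<longleftrightarrow> disjoint_family_on A {1..n} \<and> (\<Union>i\<in>{1..n}. A i) = M"

definition NSW :: "nat \<Rightarrow> ('g set \<Rightarrow> real) \<Rightarrow> (nat \<Rightarrow> 'g set) \<Rightarrow> real" where
  "NSW n v A = root n (\<Prod>i\<in>{1..n}. v (A i))"

definition EF1 :: "nat \<Rightarrow> ('g set \<Rightarrow> real) \<Rightarrow> (nat \<Rightarrow> 'g set) \<Rightarrow> bool" where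
  "EF1 n v A \<longleftrightarrow>
     (\<forall>i\<in>{1..n}. \<forall>j\<in>{1..n}. A j \<noteq> {} \<longrightarrow> (\<exists>g\<in>A j. v (A i) \<ge> v (A j - {g})))"

definition rho :: "nat \<Rightarrow> real \<Rightarrow> real" where
  "rho n \<epsilon> = root n (MIN k\<in>{1..n-1}.
     (1 - real k * \<epsilon> / real n) ^ (n - k) * (1 + real (n - k) * \<epsilon> / real n) ^ k)"

end

theory Submission
  imports Defs
begin

text \<open>EF1 bounds the differences \<open>v (A j) - v (A i)\<close> by \<open>vstar \<le> \<epsilon> * \<mu>\<close>. Hence, with \<open>I = {1..n}\<close>,
  \<open>v (A i) = \<mu> * (1 - \<epsilon> * (\<Sum>j\<in>I. \<theta> j) / n + \<epsilon> * \<theta> i)\<close> for a point \<open>\<theta>\<close> of the cube \<open>[0, 1]\<^sup>n\<close>, so the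
  product of the values is a product of nonnegative affine functions of \<open>\<theta>\<close>. Such a product is
  log-concave and so is minimal at a vertex of the cube, where \<open>k\<close> coordinates equal 1 and the
  product is \<open>\<mu> ^ n\<close> times the \<open>k\<close>-th term of \<open>rho\<close>. By AM-GM the optimum is at most \<open>\<mu>\<close>.
  The constant \<open>e\<^sup>-\<^sup>1\<^sup>/\<^sup>e\<close> comes from the case \<open>\<epsilon> = 1\<close>: with \<open>u = 1 - k / n\<close> the \<open>n\<close>-th root of the
  \<open>k\<close>-th term is at least \<open>u\<^sup>u\<close>, and \<open>u * ln u \<ge> - 1 / e\<close>.\<close>

section \<open>Minimising a product of affine functions over the cube\<close>

text \<open>Weighted AM-GM bounds each factor below by \<open>p i powr (1 - t) * q i powr t\<close>.
  Multiplying over \<open>I\<close> leaves a weighted geometric mean of the two products, which is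
  at least the smaller one.\<close>

lemma prod_affine_ge_min:
  fixes p q :: "'a \<Rightarrow> real"
  assumes "\<And>i. i \<in> I \<Longrightarrow> p i \<ge> 0" and "\<And>i. i \<in> I \<Longrightarrow> q i \<ge> 0" and t: "0 \<le> t" "t \<le> 1"
  shows "(\<Prod>i\<in>I. (1 - t) * p i + t * q i) \<ge> min (\<Prod>i\<in>I. p i) (\<Prod>i\<in>I. q i)"
proof (cases "t = 0 \<or> t = 1")
  case False
  then have t': "0 < t" "t < 1" using t by auto
  let ?P = "\<Prod>i\<in>I. p i" and ?Q = "\<Prod>i\<in>I. q i"
  have nonneg: "?P \<ge> 0" "?Q \<ge> 0" using assms by (auto intro: prod_nonneg)
  let ?m = "min ?P ?Q"
  have "?m = ?m powr (1 - t) * ?m powr t"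
    using nonneg by (auto simp flip: powr_add)
  also have "\<dots> \<le> ?P powr (1 - t) * ?Q powr t"
    using nonneg t' by (intro mult_mono powr_mono2) auto
  also have "\<dots> = (\<Prod>i\<in>I. p i powr (1 - t) * q i powr t)"
    using assms by (simp add: prod.distrib prod_powr_distrib)
  also have "\<dots> \<le> (\<Prod>i\<in>I. (1 - t) * p i + t * q i)"
  proof (intro prod_mono conjI)
    fix i assume i: "i \<in> I"
    show "p i powr (1 - t) * q i powr t \<le> (1 - t) * p i + t * q i"
    \<comment> \<open>Young's inequality is applied to positive numbers only; if one vanishes, so
      does the left-hand side, as \<open>0 powr x = 0\<close>.\<close>
    proof (cases "p i = 0 \<or> q i = 0")
      case True
      then show ?thesis using assms i by auto
    next
      case False
      then show ?thesis
        using assms(1,2)[OF i] t' by (intro Youngs_inequality_0) auto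
    qed
  qed simp
  finally show ?thesis .
qed auto

text \<open>Coordinates are rounded to 0 or 1 one after the other. At each step one of the two
  choices does not increase \<open>F\<close>, and the coordinates rounded before stay at 0 or
  1.\<close>

lemma cube_vertex_le:
  fixes F :: "('a \<Rightarrow> real) \<Rightarrow> real"
  assumes "finite J"
    and F: "\<And>\<theta> j. range \<theta> \<subseteq> {0..1} \<Longrightarrow> j \<in> J \<Longrightarrow> min (F (\<theta>(j := 0))) (F (\<theta>(j := 1))) \<le> F \<theta>"
    and "range \<theta> \<subseteq> {0..1}"
  shows "\<exists>\<theta>'. range \<theta>' \<subseteq> {0..1} \<and> \<theta>' ` J \<subseteq> {0, 1} \<and> F \<theta>' \<le> F \<theta>"
  using assms
proof (induction J)
  case empty
  then show ?case by auto
next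
  case (insert j J)
  then obtain \<eta> where \<eta>: "range \<eta> \<subseteq> {0..1}" "\<eta> ` J \<subseteq> {0, 1}" "F \<eta> \<le> F \<theta>"
    by auto
  have "min (F (\<eta>(j := 0))) (F (\<eta>(j := 1))) \<le> F \<eta>"
    by (rule insert.prems(1)[OF \<eta>(1) insertI1])
  then obtain c where c: "c \<in> {0, 1}" "F (\<eta>(j := c)) \<le> F \<eta>"
    by (auto simp: min_le_iff_disj)
  have "range (\<eta>(j := c)) \<subseteq> {0..1}" "(\<eta>(j := c)) ` insert j J \<subseteq> {0, 1}"
    using \<eta>(1,2) c(1) by auto
  then show ?case using c(2) \<eta>(3) by (meson order_trans)
qed

text \<open>The product of values with mean 1 that lie \<open>\<epsilon> * \<theta> i\<close> above
  a common base; the mean fixes this base.\<close>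

definition spread :: "real \<Rightarrow> 'a set \<Rightarrow> ('a \<Rightarrow> real) \<Rightarrow> real" where
  "spread \<epsilon> I \<theta> = (\<Prod>i\<in>I. 1 - \<epsilon> * (\<Sum>j\<in>I. \<theta> j) / real (card I) + \<epsilon> * \<theta> i)"

lemma spread_factor_nonneg:
  fixes \<theta> :: "'a \<Rightarrow> real"
  assumes "range \<theta> \<subseteq> {0..1}" and "0 \<le> \<epsilon>" "\<epsilon> \<le> 1"
  shows "1 - \<epsilon> * (\<Sum>j\<in>I. \<theta> j) / real (card I) + \<epsilon> * \<theta> i \<ge> 0"
proof -
  have \<theta>: "0 \<le> \<theta> j" "\<theta> j \<le> 1" for j using assms(1) by (auto simp: image_subset_iff)
  have "(\<Sum>j\<in>I. \<theta> j) \<le> real (card I)"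
    using sum_bounded_above[of I \<theta> 1] \<theta> by simp
  then have "(\<Sum>j\<in>I. \<theta> j) / real (card I) \<le> 1" by (auto simp: divide_le_eq_1)
  moreover have "(\<Sum>j\<in>I. \<theta> j) / real (card I) \<ge> 0"
    using \<theta> by (simp add: sum_nonneg)
  ultimately have "\<epsilon> * ((\<Sum>j\<in>I. \<theta> j) / real (card I)) \<le> 1"
    using assms(2,3) by (intro mult_le_one)
  moreover have "\<epsilon> * \<theta> i \<ge> 0" using \<theta> assms(2) by simp
  ultimately show ?thesis by simp
qed

text \<open>Each factor is affine in the single coordinate \<open>\<theta> j\<close>, so
  \<open>\<theta>\<close> is the point with parameter \<open>t = \<theta> j\<close> on the segment
  between its two roundings, and \<open>prod_affine_ge_min\<close> applies.\<close>

lemma spread_ge_min: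
  assumes "finite I" "j \<in> I" and \<theta>: "range \<theta> \<subseteq> {0..1}" and \<epsilon>: "0 \<le> \<epsilon>" "\<epsilon> \<le> 1"
  shows "min (spread \<epsilon> I (\<theta>(j := 0))) (spread \<epsilon> I (\<theta>(j := 1))) \<le> spread \<epsilon> I \<theta>"
proof -
  let ?f = "\<lambda>\<theta> i. 1 - \<epsilon> * (\<Sum>j\<in>I. \<theta> j) / real (card I) + \<epsilon> * \<theta> i"
  have t: "0 \<le> \<theta> j" "\<theta> j \<le> 1" using \<theta> by (auto simp: image_subset_iff)
  have r: "range (\<theta>(j := 0)) \<subseteq> {0..1}" "range (\<theta>(j := 1)) \<subseteq> {0..1}"
    using \<theta> by auto
  have S: "(\<Sum>l\<in>I. (\<theta>(j := c)) l) = (\<Sum>l\<in>I - {j}. \<theta> l) + c" for c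
    using assms(1,2) by (simp add: sum.remove[of _ j])
  have S': "(\<Sum>l\<in>I. \<theta> l) = (\<Sum>l\<in>I - {j}. \<theta> l) + \<theta> j"
    using assms(1,2) by (simp add: sum.remove[of _ j])
  have n: "real (card I) \<noteq> 0" using assms(1,2) by auto
  have "?f \<theta> i = (1 - \<theta> j) * ?f (\<theta>(j := 0)) i + \<theta> j * ?f (\<theta>(j := 1)) i" for i
    unfolding S S' using n by (auto simp: field_simps)
  then have "spread \<epsilon> I \<theta>
      = (\<Prod>i\<in>I. (1 - \<theta> j) * ?f (\<theta>(j := 0)) i + \<theta> j * ?f (\<theta>(j := 1)) i)"
    unfolding spread_def by (intro prod.cong) auto
  also have "\<dots> \<ge> min (\<Prod>i\<in>I. ?f (\<theta>(j := 0)) i) (\<Prod>i\<in>I. ?f (\<theta>(j := 1)) i)"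
    using spread_factor_nonneg[OF r(1) \<epsilon>] spread_factor_nonneg[OF r(2) \<epsilon>] t
    by (intro prod_affine_ge_min)
  finally show ?thesis unfolding spread_def .
qed

section \<open>Vertices of the cube and the terms of \<open>rho\<close>\<close>

definition rho_term :: "nat \<Rightarrow> real \<Rightarrow> nat \<Rightarrow> real" where
  "rho_term n \<epsilon> k =
     (1 - real k * \<epsilon> / real n) ^ (n - k) * (1 + real (n - k) * \<epsilon> / real n) ^ k"

lemma rho_eq: "rho n \<epsilon> = root n (Min (rho_term n \<epsilon> ` {1..n-1}))"
  by (simp add: rho_def rho_term_def)

lemma one_minus_frac_nonneg:
  fixes \<epsilon> :: real
  assumes "0 \<le> \<epsilon>" "\<epsilon> \<le> 1" "k \<le> n"
  shows "0 \<le> 1 - real k * \<epsilon> / real n"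
proof -
  have "real k / real n \<le> 1" using assms(3) by (auto simp: divide_le_eq_1)
  then have "real k / real n * \<epsilon> \<le> 1" using assms by (intro mult_le_one) auto
  then show ?thesis by simp
qed

lemma rho_term_nonneg:
  assumes "0 \<le> \<epsilon>" "\<epsilon> \<le> 1" "k \<le> n"
  shows "0 \<le> rho_term n \<epsilon> k"
  unfolding rho_term_def using assms one_minus_frac_nonneg[OF assms] by simp

text \<open>By \<open>1 + x \<le> exp x\<close> the two powers are at most exponentials with
  exponents \<open>- k * (n - k) * \<epsilon> / n\<close> and
  \<open>k * (n - k) * \<epsilon> / n\<close>, which cancel.\<close>

lemma rho_term_le_1:
  assumes \<epsilon>: "0 \<le> \<epsilon>" "\<epsilon> \<le> 1" "k \<le> n"
  shows "rho_term n \<epsilon> k \<le> 1"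
proof -
  have "1 - real k * \<epsilon> / real n \<le> exp (- (real k * \<epsilon> / real n))"
    using exp_ge_add_one_self[of "- (real k * \<epsilon> / real n)"] by simp
  moreover have "1 + real (n - k) * \<epsilon> / real n \<le> exp (real (n - k) * \<epsilon> / real n)"
    by (rule exp_ge_add_one_self)
  ultimately have "rho_term n \<epsilon> k
      \<le> exp (- (real k * \<epsilon> / real n)) ^ (n - k) * exp (real (n - k) * \<epsilon> / real n) ^ k"
    unfolding rho_term_def using one_minus_frac_nonneg[OF assms] \<epsilon>
    by (intro mult_mono power_mono) auto
  also have "\<dots> = 1"
    by (simp flip: exp_of_nat_mult exp_add)
  finally show ?thesis .
qed

lemma Min_rho_term_le_1:
  assumes "n \<ge> 2" "0 \<le> \<epsilon>" "\<epsilon> \<le> 1"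
  shows "Min (rho_term n \<epsilon> ` {1..n-1}) \<le> 1"
proof -
  have "Min (rho_term n \<epsilon> ` {1..n-1}) \<le> rho_term n \<epsilon> 1"
    using assms by (intro Min_le) auto
  also have "\<dots> \<le> 1" using assms by (intro rho_term_le_1) auto
  finally show ?thesis .
qed

text \<open>Here \<open>k\<close> counts the coordinates equal to 1. Each of these gives the factor
  \<open>1 - k * \<epsilon> / n + \<epsilon>\<close>, that is
  \<open>1 + (n - k) * \<epsilon> / n\<close>; the others give
  \<open>1 - k * \<epsilon> / n\<close>.\<close>

lemma spread_vertex:
  assumes "finite I" "\<theta> ` I \<subseteq> {0, 1}" and n: "card I = n" "n \<ge> 1"
  shows "\<exists>k\<le>n. spread \<epsilon> I \<theta> = rho_term n \<epsilon> k"
proof -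
  let ?K = "{i \<in> I. \<theta> i = 1}"
  define k where "k = card ?K"
  have kn: "k \<le> n" using assms(1) n(1) by (auto simp: k_def intro!: card_mono)
  have cI: "card (I - ?K) = n - k"
    using assms(1) n(1) by (simp add: k_def card_Diff_subset)
  have sK: "(\<Sum>i\<in>I. \<theta> i) = real k"
  proof -
    have "(\<Sum>i\<in>I. \<theta> i) = (\<Sum>i\<in>I. if \<theta> i = 1 then 1 else 0)"
      using assms(2) by (intro sum.cong) auto
    also have "\<dots> = real k" using assms(1) by (simp add: k_def sum.If_cases Int_def)
    finally show ?thesis .
  qed
  have split: "(\<Prod>i\<in>I. f i) = (\<Prod>i\<in>I - ?K. f i) * (\<Prod>i\<in>?K. f i)" for f :: "'a \<Rightarrow> real"
    using assms(1) by (intro prod.subset_diff) auto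
  have "spread \<epsilon> I \<theta>
      = (\<Prod>i\<in>I - ?K. 1 - real k * \<epsilon> / real n) * (\<Prod>i\<in>?K. 1 + real (n - k) * \<epsilon> / real n)"
    unfolding spread_def split sK n(1)
  proof (intro arg_cong2[where f = "(*)"] prod.cong refl)
    fix i assume "i \<in> I - ?K"
    then have "\<theta> i = 0" using assms(2) by auto
    then show "1 - \<epsilon> * real k / real n + \<epsilon> * \<theta> i = 1 - real k * \<epsilon> / real n"
      by (simp add: mult.commute)
  next
    fix i assume "i \<in> ?K"
    then show "1 - \<epsilon> * real k / real n + \<epsilon> * \<theta> i = 1 + real (n - k) * \<epsilon> / real n"
      using kn n(2) by (simp add: of_nat_diff field_simps)
  qed
  also have "\<dots> = rho_term n \<epsilon> k"
    by (simp add: rho_term_def cI flip: k_def)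
  finally show ?thesis using kn by auto
qed

lemma spread_ge_Min_rho_term:
  assumes I: "finite I" "card I = n" "n \<ge> 2"
    and \<epsilon>: "0 \<le> \<epsilon>" "\<epsilon> \<le> 1" and \<theta>: "range \<theta> \<subseteq> {0..1}"
  shows "spread \<epsilon> I \<theta> \<ge> Min (rho_term n \<epsilon> ` {1..n-1})"
proof -
  obtain \<eta> where \<eta>: "\<eta> ` I \<subseteq> {0, 1}" "spread \<epsilon> I \<eta> \<le> spread \<epsilon> I \<theta>"
    using cube_vertex_le[OF I(1) spread_ge_min[OF I(1) _ _ \<epsilon>] \<theta>] by blast
  obtain k where k: "k \<le> n" "spread \<epsilon> I \<eta> = rho_term n \<epsilon> k"
    using spread_vertex[OF I(1) \<eta>(1) I(2)] I(3) by force
  have "Min (rho_term n \<epsilon> ` {1..n-1}) \<le> rho_term n \<epsilon> k"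
  proof (cases "k \<in> {1..n-1}")
    case True
    then show ?thesis by (intro Min_le) auto
  next
    case False
    \<comment> \<open>These two vertices lie outside the range of the minimum. All factors equal 1
      there, and the minimum does not exceed 1.\<close>
    then have "k = 0 \<or> k = n" using k(1) by auto
    then have "rho_term n \<epsilon> k = 1" by (auto simp: rho_term_def)
    then show ?thesis using Min_rho_term_le_1[OF I(3) \<epsilon>] by simp
  qed
  then show ?thesis using \<eta>(2) k(2) by simp
qed

text \<open>Measuring the values from their minimum \<open>m\<close> in units of
  \<open>\<epsilon> * \<mu>\<close> gives a point of the cube, and the product becomes
  \<open>\<mu> ^ n\<close> times its \<open>spread\<close>.\<close>

lemma prod_ge_of_bounded_gap:
  fixes x :: "'a \<Rightarrow> real"
  assumes I: "finite I" "card I = n" "n \<ge> 2"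
    and \<epsilon>: "0 \<le> \<epsilon>" "\<epsilon> \<le> 1" and \<mu>: "\<mu> > 0" "(\<Sum>i\<in>I. x i) = real n * \<mu>"
    and gap: "\<And>i j. i \<in> I \<Longrightarrow> j \<in> I \<Longrightarrow> x j - x i \<le> \<epsilon> * \<mu>"
  shows "(\<Prod>i\<in>I. x i) \<ge> \<mu> ^ n * Min (rho_term n \<epsilon> ` {1..n-1})"
proof -
  define m where "m = Min (x ` I)"
  have ne: "I \<noteq> {}" using I by auto
  have "m \<in> x ` I" unfolding m_def using I(1) ne by (intro Min_in) auto
  then obtain a where a: "a \<in> I" "m = x a" by auto
  have m: "m \<le> x i" if "i \<in> I" for i
    unfolding m_def using I(1) that by simp
  \<comment> \<open>The default 0 keeps the whole range of \<open>\<theta>\<close> in the unit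
    interval. For \<open>\<epsilon> = 0\<close> the quotient is 0 as well, which fits because the
    gap bound then makes all values equal.\<close>
  define \<theta> where "\<theta> i = (if i \<in> I then (x i - m) / (\<epsilon> * \<mu>) else 0)" for i
  have up: "x i - m \<le> \<epsilon> * \<mu>" if "i \<in> I" for i using gap[OF a(1) that] a(2) by simp
  have \<theta>: "0 \<le> \<theta> i" "\<theta> i \<le> 1" for i
    using m[of i] up[of i] \<epsilon> \<mu> by (auto simp: \<theta>_def divide_le_eq_1)
  have x: "x i = m + \<epsilon> * \<mu> * \<theta> i" if "i \<in> I" for i
  proof (cases "\<epsilon> = 0")
    case True
    then show ?thesis using m[OF that] up[OF that] by simp
  next
    case False
    then show ?thesis using \<mu> that by (simp add: \<theta>_def)
  qed
  \<comment> \<open>Prescribing the sum determines \<open>m\<close> from \<open>\<theta>\<close>, so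
    \<open>m\<close> can be eliminated.\<close>
  have "real n * \<mu> = (\<Sum>i\<in>I. m + \<epsilon> * \<mu> * \<theta> i)"
    unfolding \<mu>(2)[symmetric] using x by (intro sum.cong) auto
  also have "\<dots> = real n * m + \<epsilon> * \<mu> * (\<Sum>i\<in>I. \<theta> i)"
    by (simp add: sum.distrib sum_distrib_left I(2))
  finally have "m = \<mu> * (1 - \<epsilon> * (\<Sum>i\<in>I. \<theta> i) / real (card I))"
    using I(2,3) by (simp add: field_simps)
  then have "x i = \<mu> * (1 - \<epsilon> * (\<Sum>i\<in>I. \<theta> i) / real (card I) + \<epsilon> * \<theta> i)" if "i \<in> I" for i
    using x[OF that] by (simp add: algebra_simps)
  then have "(\<Prod>i\<in>I. x i)
      = (\<Prod>i\<in>I. \<mu> * (1 - \<epsilon> * (\<Sum>i\<in>I. \<theta> i) / real (card I) + \<epsilon> * \<theta> i))"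
    by (intro prod.cong) auto
  also have "\<dots> = \<mu> ^ n * spread \<epsilon> I \<theta>"
    by (simp add: prod.distrib spread_def I(2))
  finally show ?thesis
    using spread_ge_Min_rho_term[OF I \<epsilon>, of \<theta>] \<theta> \<mu>(1) by (auto simp: image_subset_iff)
qed

section \<open>The universal constant\<close>

lemma exp_minus_inverse_e_le_rho_1:
  assumes "n \<ge> 2"
  shows "exp (- (1 / exp 1)) \<le> rho n 1"
proof -
  have "exp (- (1 / exp 1)) ^ n \<le> rho_term n 1 k" if k: "k \<in> {1..n-1}" for k
  proof -
    define u where "u = 1 - real k / real n"
    have kn: "k < n" using k assms by auto
    then have u: "u > 0" "real n * u = real (n - k)"
      by (auto simp: u_def field_simps of_nat_diff)
    \<comment> \<open>The tangent bound for \<open>ln\<close> is sharp at argument 1, that is at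
      \<open>u = 1 / exp 1\<close>, where \<open>u * ln u\<close> is minimal.\<close>
    have "ln (1 / (exp 1 * u)) \<le> 1 / (exp 1 * u) - 1"
      using u by (intro ln_le_minus_one) auto
    then have "- ln u \<le> 1 / (exp 1 * u)"
      using u by (simp add: ln_div ln_mult)
    then have "u * (- ln u) \<le> u * (1 / (exp 1 * u))"
      using u by (intro mult_left_mono) auto
    also have "\<dots> = 1 / exp 1" using u by simp
    finally have "real n * (- (1 / exp 1)) \<le> real n * (u * ln u)"
      by (intro mult_left_mono) auto
    then have "exp (- (1 / exp 1)) ^ n \<le> exp (real n * (u * ln u))"
      by (simp flip: exp_of_nat_mult)
    also have "real n * (u * ln u) = real (n - k) * ln u" using u(2) by simp
    also have "exp (real (n - k) * ln u) = u ^ (n - k)"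
      using u(1) by (simp add: exp_of_nat_mult)
    \<comment> \<open>The second power in the term is at least 1.\<close>
    also have "\<dots> \<le> u ^ (n - k) * (1 + real (n - k) / real n) ^ k"
      using u(1) by (simp add: one_le_power)
    also have "\<dots> = rho_term n 1 k" by (simp add: rho_term_def u_def)
    finally show ?thesis .
  qed
  then have "exp (- (1 / exp 1)) ^ n \<le> Min (rho_term n 1 ` {1..n-1})"
    using assms by (intro Min.boundedI) auto
  then have "root n (exp (- (1 / exp 1)) ^ n) \<le> rho n 1"
    unfolding rho_eq using assms by simp
  then show ?thesis using assms by (simp add: real_root_power_cancel)
qed

section \<open>Allocations, AM-GM and EF1\<close>

lemma sum_allocation:
  assumes "finite M" "additive_valuation M v" "allocation n M A"
  shows "(\<Sum>i\<in>{1..n}. v (A i)) = v M"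
proof -
  have sub: "A i \<subseteq> M" if "i \<in> {1..n}" for i
    using assms(3) that by (auto simp: allocation_def)
  have add: "v S = (\<Sum>g\<in>S. v {g})" if "S \<subseteq> M" for S
    using assms(2) that by (simp add: additive_valuation_def)
  have "(\<Sum>g\<in>M. v {g}) = (\<Sum>g\<in>(\<Union>i\<in>{1..n}. A i). v {g})"
    using assms(3) by (simp add: allocation_def)
  also have "\<dots> = (\<Sum>i\<in>{1..n}. \<Sum>g\<in>A i. v {g})"
    using assms sub by (intro sum.UNION_disjoint)
      (auto simp: allocation_def disjoint_family_on_def intro: finite_subset)
  also have "\<dots> = (\<Sum>i\<in>{1..n}. v (A i))"
    using sub by (intro sum.cong refl add[symmetric]) auto
  finally show ?thesis using add[of M] by simp
qed

text \<open>AM-GM for the bundle values, whose sum is \<open>v M\<close>. It serves as the upper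
  bound for the optimum.\<close>

lemma NSW_le_mean:
  assumes "n \<ge> 1" "finite M" "additive_valuation M v" "allocation n M A"
  shows "NSW n v A \<le> v M / real n"
proof -
  have "0 \<le> v (A i)" if "i \<in> {1..n}" for i
    using assms(3,4) that unfolding additive_valuation_def allocation_def by blast
  then have "(\<Prod>i\<in>{1..n}. v (A i)) powr (1 / card {1..n}) \<le> (\<Sum>i\<in>{1..n}. v (A i) / card {1..n})"
    and "0 \<le> (\<Prod>i\<in>{1..n}. v (A i))"
    using assms(1) by (intro arith_geom_mean prod_nonneg; simp)+
  then show ?thesis
    using assms(1) sum_allocation[OF assms(2-4)]
    by (simp add: NSW_def root_powr_inverse flip: sum_divide_distrib)
qed

text \<open>Removing the good \<open>g\<close> supplied by EF1 costs at most \<open>c\<close> and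
  leaves a bundle worth at most \<open>v (A i)\<close>. An empty \<open>A j\<close> is treated
  apart, since EF1 supplies no good there.\<close>

lemma EF1_gap:
  assumes "finite M" "additive_valuation M v" "allocation n M A" "EF1 n v A"
    and ij: "i \<in> {1..n}" "j \<in> {1..n}"
    and c: "0 \<le> c" "\<And>g. g \<in> M \<Longrightarrow> v {g} \<le> c"
  shows "v (A j) - v (A i) \<le> c"
proof -
  have sub: "A l \<subseteq> M" if "l \<in> {1..n}" for l
    using assms(3) that by (auto simp: allocation_def)
  have add: "v S = (\<Sum>g\<in>S. v {g})" if "S \<subseteq> M" for S
    using assms(2) that by (simp add: additive_valuation_def)
  show ?thesis
  proof (cases "A j = {}")
    case True
    have "v {} = 0" using add[of "{}"] by simp
    moreover have "v (A i) \<ge> 0"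
      using assms(2) sub[OF ij(1)] unfolding additive_valuation_def by blast
    ultimately show ?thesis using True c(1) by simp
  next
    case False
    then obtain g where g: "g \<in> A j" "v (A i) \<ge> v (A j - {g})"
      using assms(4) ij unfolding EF1_def by blast
    have fin: "finite (A j)" using sub[OF ij(2)] assms(1) by (rule finite_subset)
    have "A j - {g} \<subseteq> M" using sub[OF ij(2)] by blast
    then have "v (A j) = v {g} + v (A j - {g})"
      using add[OF sub[OF ij(2)]] add[of "A j - {g}"]
        sum.remove[OF fin g(1), of "\<lambda>g. v {g}"] by simp
    moreover have "v {g} \<le> c" using c(2) g(1) sub[OF ij(2)] by auto
    ultimately show ?thesis using g(2) by simp
  qed
qed

theorem theorem4:
  fixes n :: nat and M :: "'g set" and v :: "'g set \<Rightarrow> real"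
    and Astar A :: "nat \<Rightarrow> 'g set" and \<mu> vstar \<epsilon> :: real
  assumes "n \<ge> 2"
    and "finite M"
    and "additive_valuation M v"
    and "is_arg_max (NSW n v) (allocation n M) Astar"
    and "NSW n v Astar > 0"
    and "\<mu> = v M / real n"
    and "vstar = Max ((\<lambda>g. v {g}) ` M)"
    and "0 \<le> \<epsilon>" and "\<epsilon> \<le> 1"
    and "vstar \<le> \<epsilon> * \<mu>"
    and "allocation n M A"
    and "EF1 n v A"
  shows "NSW n v A / NSW n v Astar \<ge> max (exp (- (1 / exp 1))) (rho n \<epsilon>)"
proof -
  have le: "NSW n v Astar \<le> \<mu>"
    using NSW_le_mean[of n M v Astar] assms by (simp add: is_arg_max_def)
  then have \<mu>: "\<mu> > 0" using assms(5) by simp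
  have good: "v {g} \<le> \<epsilon> * \<mu>" if "g \<in> M" for g
    using assms(2,7,10) that by (auto intro: order_trans[OF Max_ge])
  have sum: "(\<Sum>i\<in>{1..n}. v (A i)) = real n * \<mu>"
    using sum_allocation[OF assms(2,3,11)] assms(1,6) by simp
  \<comment> \<open>The small-item condition persists when \<open>\<epsilon>\<close> grows to
    \<open>\<delta>\<close>. Taking \<open>\<delta> = \<epsilon>\<close> gives one bound and
    \<open>\<delta> = 1\<close> the universal constant, with no need for monotonicity of
    \<open>rho\<close>.\<close>
  have ratio: "rho n \<delta> \<le> NSW n v A / NSW n v Astar" and "0 \<le> rho n \<delta>"
    if \<delta>: "\<epsilon> \<le> \<delta>" "\<delta> \<le> 1" for \<delta>
  proof -
    let ?m = "Min (rho_term n \<delta> ` {1..n-1})"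
    have \<delta>0: "0 \<le> \<delta>" using \<delta> assms(8) by simp
    have "\<epsilon> * \<mu> \<le> \<delta> * \<mu>" using \<delta> \<mu> by simp
    then have "v {g} \<le> \<delta> * \<mu>" if "g \<in> M" for g
      using good[OF that] by simp
    then have "v (A j) - v (A i) \<le> \<delta> * \<mu>" if "i \<in> {1..n}" "j \<in> {1..n}" for i j
      using that \<mu> \<delta>0 by (intro EF1_gap[OF assms(2,3,11,12)]) auto
    then have "\<mu> ^ n * ?m \<le> (\<Prod>i\<in>{1..n}. v (A i))"
      using assms(1) \<delta>0 \<delta> \<mu> sum by (intro prod_ge_of_bounded_gap) auto
    then have "root n (\<mu> ^ n * ?m) \<le> NSW n v A"
      unfolding NSW_def using assms(1) by simp
    then have *: "\<mu> * rho n \<delta> \<le> NSW n v A"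
      using assms(1) \<mu> by (simp add: real_root_mult real_root_power_cancel rho_eq)
    have "?m \<ge> 0"
      using assms(1) \<delta>0 \<delta> by (intro Min.boundedI) (auto intro!: rho_term_nonneg)
    then show nn: "0 \<le> rho n \<delta>" unfolding rho_eq using assms(1) by simp
    \<comment> \<open>Nonnegativity of \<open>rho\<close> allows \<open>\<mu>\<close> to be replaced
      by the smaller optimum.\<close>
    have "NSW n v Astar * rho n \<delta> \<le> NSW n v A"
      using mult_right_mono[OF le nn] * by linarith
    then show "rho n \<delta> \<le> NSW n v A / NSW n v Astar"
      using assms(5) by (simp add: field_simps)
  qed
  show ?thesis
    using ratio[of \<epsilon>] ratio[of 1] exp_minus_inverse_e_le_rho_1[OF assms(1)] assms(9) by auto
qed

end
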